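(* Let $k$ be a field and let $A$ be an associative (not necessarily unital) $k$-algebra such that $A = P_0 + V_0$ (sum of subspaces) for two abelian subalgebras $P_0$ and $V_0$ of $A$. Then $A$ is metabelian.
   Context: All algebras are associative, not necessarily unital, over an arbitrary field $k$. An algebra or subalgebra is called abelian if $xy = 0$ for all $x, y$ in it. An algebra $A$ is metabelian if there exist abelian algebras $W$ and $Q$ and an exact sequence of algebra morphisms $0 \to W \xrightarrow{i} A \xrightarrow{\pi} Q \to 0$ (that is, $i$ is injective, $\pi$ is surjective, and $\mathrm{Im}(i) = \mathrm{Ker}(\pi)$). *)

theory Defs
  imports "HOL-Algebra.Module" "HOL-Algebra.AbelCoset"
begin

text \<open>
  The locale \<^locale>\<open>algebra\<close> of the library requires a commutative ring with unit. An associative,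
  not necessarily unital, algebra is therefore introduced here as a module with an associative
  bilinear multiplication. Since the record type of modules has a field for a multiplicative unit,
  there is a value \<open>\<one>\<^bsub>A\<^esub>\<close>, but nothing is assumed about it and no definition below mentions it.
\<close>

locale nonunital_algebra = module K A + field K
  for K (structure) and A (structure) +
  assumes mult_closed:
      "\<lbrakk>x \<in> carrier A; y \<in> carrier A\<rbrakk> \<Longrightarrow> x \<otimes>\<^bsub>A\<^esub> y \<in> carrier A"
    and mult_assoc:
      "\<lbrakk>x \<in> carrier A; y \<in> carrier A; z \<in> carrier A\<rbrakk>
        \<Longrightarrow> (x \<otimes>\<^bsub>A\<^esub> y) \<otimes>\<^bsub>A\<^esub> z = x \<otimes>\<^bsub>A\<^esub> (y \<otimes>\<^bsub>A\<^esub> z)"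
    and mult_l_distr:
      "\<lbrakk>x \<in> carrier A; y \<in> carrier A; z \<in> carrier A\<rbrakk>
        \<Longrightarrow> (x \<oplus>\<^bsub>A\<^esub> y) \<otimes>\<^bsub>A\<^esub> z = x \<otimes>\<^bsub>A\<^esub> z \<oplus>\<^bsub>A\<^esub> y \<otimes>\<^bsub>A\<^esub> z"
    and mult_r_distr:
      "\<lbrakk>x \<in> carrier A; y \<in> carrier A; z \<in> carrier A\<rbrakk>
        \<Longrightarrow> z \<otimes>\<^bsub>A\<^esub> (x \<oplus>\<^bsub>A\<^esub> y) = z \<otimes>\<^bsub>A\<^esub> x \<oplus>\<^bsub>A\<^esub> z \<otimes>\<^bsub>A\<^esub> y"
    and mult_smult_l:
      "\<lbrakk>a \<in> carrier K; x \<in> carrier A; y \<in> carrier A\<rbrakk>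
        \<Longrightarrow> (a \<odot>\<^bsub>A\<^esub> x) \<otimes>\<^bsub>A\<^esub> y = a \<odot>\<^bsub>A\<^esub> (x \<otimes>\<^bsub>A\<^esub> y)"
    and mult_smult_r:
      "\<lbrakk>a \<in> carrier K; x \<in> carrier A; y \<in> carrier A\<rbrakk>
        \<Longrightarrow> x \<otimes>\<^bsub>A\<^esub> (a \<odot>\<^bsub>A\<^esub> y) = a \<odot>\<^bsub>A\<^esub> (x \<otimes>\<^bsub>A\<^esub> y)"

locale abelian_algebra = nonunital_algebra +
  assumes mult_null: "\<lbrakk>x \<in> carrier A; y \<in> carrier A\<rbrakk> \<Longrightarrow> x \<otimes>\<^bsub>A\<^esub> y = \<zero>\<^bsub>A\<^esub>"

definition nonunital_subalgebra ::
    "'a set \<Rightarrow> ('k, 'm) ring_scheme \<Rightarrow> ('k, 'a, 'n) module_scheme \<Rightarrow> bool" where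
  "nonunital_subalgebra S K A \<longleftrightarrow>
     submodule S K A \<and> (\<forall>x\<in>S. \<forall>y\<in>S. x \<otimes>\<^bsub>A\<^esub> y \<in> S)"

definition abelian_subalgebra ::
    "'a set \<Rightarrow> ('k, 'm) ring_scheme \<Rightarrow> ('k, 'a, 'n) module_scheme \<Rightarrow> bool" where
  "abelian_subalgebra S K A \<longleftrightarrow>
     nonunital_subalgebra S K A \<and> (\<forall>x\<in>S. \<forall>y\<in>S. x \<otimes>\<^bsub>A\<^esub> y = \<zero>\<^bsub>A\<^esub>)"

definition nonunital_algebra_hom ::
    "('k, 'm) ring_scheme \<Rightarrow> ('k, 'a, 'n) module_scheme \<Rightarrow> ('k, 'b, 'p) module_scheme
      \<Rightarrow> ('a \<Rightarrow> 'b) set" where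
  "nonunital_algebra_hom K A B =
     {h \<in> carrier A \<rightarrow> carrier B.
        (\<forall>x\<in>carrier A. \<forall>y\<in>carrier A. h (x \<oplus>\<^bsub>A\<^esub> y) = h x \<oplus>\<^bsub>B\<^esub> h y) \<and>
        (\<forall>x\<in>carrier A. \<forall>y\<in>carrier A. h (x \<otimes>\<^bsub>A\<^esub> y) = h x \<otimes>\<^bsub>B\<^esub> h y) \<and>
        (\<forall>a\<in>carrier K. \<forall>x\<in>carrier A. h (a \<odot>\<^bsub>A\<^esub> x) = a \<odot>\<^bsub>B\<^esub> h x)}"

definition short_exact ::
    "('k, 'm) ring_scheme \<Rightarrow> ('k, 'w, 'n) module_scheme \<Rightarrow> ('w \<Rightarrow> 'a)
      \<Rightarrow> ('k, 'a, 'p) module_scheme \<Rightarrow> ('a \<Rightarrow> 'q) \<Rightarrow> ('k, 'q, 'r) module_scheme \<Rightarrow> bool" where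
  "short_exact K W i A \<pi> Q \<longleftrightarrow>
     i \<in> nonunital_algebra_hom K W A \<and> \<pi> \<in> nonunital_algebra_hom K A Q \<and>
     inj_on i (carrier W) \<and> \<pi> ` carrier A = carrier Q \<and>
     i ` carrier W = a_kernel A Q \<pi>"

text \<open>
  HOL has no quantification over types, so the existential quantifiers below must fix the types in
  which the carriers of \<open>W\<close> and \<open>Q\<close> live. The types \<open>'a\<close> (for ideals of \<open>A\<close>) and \<open>'a set\<close>
  (for fibres of \<open>\<pi>\<close>) are large enough: lemma \<open>metabelianI\<close> below obtains \<open>metabelian K A\<close> from
  an exact sequence in which \<open>W\<close> and \<open>Q\<close> have carriers in arbitrary types.
\<close>

definition metabelian :: "('k, 'm) ring_scheme \<Rightarrow> ('k, 'a, 'n) module_scheme \<Rightarrow> bool" where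
  "metabelian K A \<longleftrightarrow>
     (\<exists>(W :: ('k, 'a) module) (Q :: ('k, 'a set) module) i \<pi>.
        abelian_algebra K W \<and> abelian_algebra K Q \<and> short_exact K W i A \<pi> Q)"

definition transport ::
    "('b \<Rightarrow> 'c) \<Rightarrow> ('k, 'b, 'n) module_scheme \<Rightarrow> ('k, 'c) module" where
  "transport h B = (let g = inv_into (carrier B) h in
     \<lparr>carrier = h ` carrier B, mult = (\<lambda>x y. h (g x \<otimes>\<^bsub>B\<^esub> g y)), one = h \<one>\<^bsub>B\<^esub>,
      zero = h \<zero>\<^bsub>B\<^esub>, add = (\<lambda>x y. h (g x \<oplus>\<^bsub>B\<^esub> g y)), smult = (\<lambda>a x. h (a \<odot>\<^bsub>B\<^esub> g x))\<rparr>)"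

lemma transport_simps:
  assumes "inj_on h (carrier B)"
  shows "carrier (transport h B) = h ` carrier B"
    and "\<zero>\<^bsub>transport h B\<^esub> = h \<zero>\<^bsub>B\<^esub>"
    and "\<lbrakk>x \<in> carrier B; y \<in> carrier B\<rbrakk> \<Longrightarrow> h x \<otimes>\<^bsub>transport h B\<^esub> h y = h (x \<otimes>\<^bsub>B\<^esub> y)"
    and "\<lbrakk>x \<in> carrier B; y \<in> carrier B\<rbrakk> \<Longrightarrow> h x \<oplus>\<^bsub>transport h B\<^esub> h y = h (x \<oplus>\<^bsub>B\<^esub> y)"
    and "x \<in> carrier B \<Longrightarrow> a \<odot>\<^bsub>transport h B\<^esub> h x = h (a \<odot>\<^bsub>B\<^esub> x)"
  using assms by (simp_all add: transport_def Let_def)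

lemma abelian_algebra_transport:
  assumes "abelian_algebra K B" and inj: "inj_on h (carrier B)"
  shows "abelian_algebra K (transport h B)"
proof -
  interpret B: abelian_algebra K B by fact
  note s = transport_simps[OF inj]
  have grp: "abelian_group (transport h B)"
  proof (rule abelian_groupI)
    fix x assume "x \<in> carrier (transport h B)"
    then obtain u where u: "u \<in> carrier B" "x = h u" by (auto simp: s)
    show "\<exists>y\<in>carrier (transport h B). y \<oplus>\<^bsub>transport h B\<^esub> x = \<zero>\<^bsub>transport h B\<^esub>"
      using u by (intro bexI[of _ "h (\<ominus>\<^bsub>B\<^esub> u)"]) (auto simp: s B.M.l_neg)
  qed (auto simp: s B.M.a_ac)
  have mod: "module K (transport h B)"
    by (rule moduleI[OF B.R.is_cring grp])
       (auto simp: s B.smult_l_distr B.smult_r_distr B.smult_assoc1)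
  show ?thesis
    apply (intro abelian_algebra.intro nonunital_algebra.intro mod B.field_axioms
        nonunital_algebra_axioms.intro abelian_algebra_axioms.intro)
    by (auto simp: s B.mult_closed B.mult_assoc B.mult_l_distr B.mult_r_distr
        B.mult_smult_l B.mult_smult_r B.mult_null intro!: arg_cong[of _ _ h])
qed

lemma metabelianI:
  fixes W :: "('k, 'w, 'n1) module_scheme" and Q :: "('k, 'q, 'n2) module_scheme"
    and A :: "('k, 'a, 'n3) module_scheme"
  assumes W: "abelian_algebra K W" and Q: "abelian_algebra K Q"
    and ex: "short_exact K W i A \<pi> Q"
  shows "metabelian K A"
proof -
  interpret W: abelian_algebra K W by fact
  interpret Q: abelian_algebra K Q by fact
  define f where "f q = {x \<in> carrier A. \<pi> x = q}" for q
  have i: "i \<in> nonunital_algebra_hom K W A" and p: "\<pi> \<in> nonunital_algebra_hom K A Q"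
    and ii: "inj_on i (carrier W)" and ps: "\<pi> ` carrier A = carrier Q"
    and ker: "i ` carrier W = a_kernel A Q \<pi>"
    using ex by (auto simp: short_exact_def)
  have fi: "inj_on f (carrier Q)"
  proof (rule inj_onI)
    fix q r assume "q \<in> carrier Q" and e: "f q = f r"
    then have "q \<in> \<pi> ` carrier A" using ps by simp
    then obtain x where "x \<in> f q" and "\<pi> x = q" unfolding f_def by blast
    moreover from this e have "x \<in> f r" by simp
    ultimately show "q = r" by (simp add: f_def)
  qed
  have pc: "\<pi> x \<in> carrier Q" if "x \<in> carrier A" for x using that ps by auto
  note sW = transport_simps[OF ii] and sQ = transport_simps[OF fi]
  have "id \<in> nonunital_algebra_hom K (transport i W) A"
    using i by (auto simp: nonunital_algebra_hom_def sW Pi_def)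
  moreover have "f \<circ> \<pi> \<in> nonunital_algebra_hom K A (transport f Q)"
    using p by (auto simp: nonunital_algebra_hom_def sQ pc)
  moreover have "(f \<circ> \<pi>) ` carrier A = carrier (transport f Q)"
    by (simp add: sQ flip: ps image_image)
  moreover have "id ` carrier (transport i W) = a_kernel A (transport f Q) (f \<circ> \<pi>)"
    using ker pc fi by (auto simp: sW sQ a_kernel_def kernel_def inj_on_eq_iff)
  ultimately have "short_exact K (transport i W) id A (f \<circ> \<pi>) (transport f Q)"
    by (simp add: short_exact_def)
  then show ?thesis
    unfolding metabelian_def
    using abelian_algebra_transport[OF W ii] abelian_algebra_transport[OF Q fi] by blast
qed

end

theory Submission
  imports Defs
begin

text \<open>
  If \<open>P\<close> and \<open>V\<close> are abelian with \<open>A = P + V\<close>, then a product of four factors from \<open>P \<union> V\<close> can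
  only be nonzero if the factors alternate. But writing \<open>v q = p' + v'\<close> with \<open>p' \<in> P\<close> and \<open>v' \<in> V\<close>
  gives \<open>p (v q) w = (p p') w + p (v' w) = 0\<close>, and symmetrically for \<open>v p w q\<close>. Hence all products
  of four elements vanish, so that the ideal generated by all products of two elements squares to
  zero, and the quotient by it is abelian.
\<close>

text \<open>The multiplication is constantly the zero coset, which is the product induced from
  \<open>A\<close> as soon as \<open>N\<close> contains all products of \<open>A\<close>. The union
  in \<open>smult\<close> avoids choosing a representative of \<open>X\<close>.\<close>

definition null_quotient :: "('k, 'a, 'n) module_scheme \<Rightarrow> 'a set \<Rightarrow> ('k, 'a set) module" where
  "null_quotient A N =
     \<lparr>carrier = a_rcosets\<^bsub>A\<^esub> N, mult = (\<lambda>_ _. N), one = N, zero = N, add = set_add A,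
      smult = (\<lambda>a X. \<Union>x\<in>X. N +>\<^bsub>A\<^esub> (a \<odot>\<^bsub>A\<^esub> x))\<rparr>"

context nonunital_algebra
begin

lemma submodule_abelian_subgroup:
  assumes "submodule N K A"
  shows "abelian_subgroup N A"
proof -
  interpret N: submodule N K A by fact
  show ?thesis
    by (rule abelian_subgroupI3)
      (auto intro: additive_subgroup.intro N.subgroup_axioms M.abelian_group_axioms)
qed

text \<open>Representatives of one coset differ by an element of \<open>N\<close>, which scalars
  keep in \<open>N\<close>; hence all cosets in the union coincide.\<close>

lemma null_quotient_smult:
  assumes "submodule N K A" and a: "a \<in> carrier K" and x: "x \<in> carrier A"
  shows "a \<odot>\<^bsub>null_quotient A N\<^esub> (N +>\<^bsub>A\<^esub> x) = N +>\<^bsub>A\<^esub> (a \<odot>\<^bsub>A\<^esub> x)"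
proof -
  interpret N: submodule N K A by fact
  interpret N: abelian_subgroup N A using assms(1) by (rule submodule_abelian_subgroup)
  have "N +>\<^bsub>A\<^esub> (a \<odot>\<^bsub>A\<^esub> y) = N +>\<^bsub>A\<^esub> (a \<odot>\<^bsub>A\<^esub> x)" if y: "y \<in> N +>\<^bsub>A\<^esub> x" for y
  proof -
    obtain n where n: "n \<in> N" "y = n \<oplus>\<^bsub>A\<^esub> x"
      using y by (auto simp: a_r_coset_def')
    then have "n \<in> carrier A" by (simp add: N.a_Hcarr)
    then have "a \<odot>\<^bsub>A\<^esub> y = a \<odot>\<^bsub>A\<^esub> n \<oplus>\<^bsub>A\<^esub> a \<odot>\<^bsub>A\<^esub> x"
      using n a x by (simp add: smult_r_distr)
    moreover have "a \<odot>\<^bsub>A\<^esub> n \<in> N" using a n(1) by (rule N.smult_closed)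
    ultimately have "a \<odot>\<^bsub>A\<^esub> y \<in> N +>\<^bsub>A\<^esub> (a \<odot>\<^bsub>A\<^esub> x)"
      by (auto simp: a_r_coset_def')
    then show ?thesis
      using a x by (intro N.a_repr_independence'[symmetric]) auto
  qed
  moreover have "x \<in> N +>\<^bsub>A\<^esub> x" using x by (rule N.a_rcos_self)
  ultimately have "(\<Union>y\<in>N +>\<^bsub>A\<^esub> x. N +>\<^bsub>A\<^esub> (a \<odot>\<^bsub>A\<^esub> y)) = N +>\<^bsub>A\<^esub> (a \<odot>\<^bsub>A\<^esub> x)"
    by blast
  then show ?thesis
    by (simp add: null_quotient_def)
qed

lemma null_quotient_abelian_algebra:
  assumes N: "submodule N K A"
  shows "abelian_algebra K (null_quotient A N)"
proof -
  interpret N: submodule N K A by fact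
  interpret N: abelian_subgroup N A using N by (rule submodule_abelian_subgroup)
  let ?Q = "null_quotient A N"
  have zero: "N +>\<^bsub>A\<^esub> \<zero>\<^bsub>A\<^esub> = N"
    by (simp add: N.a_rcos_const)
  have carr: "carrier ?Q = (\<lambda>x. N +>\<^bsub>A\<^esub> x) ` carrier A"
    by (auto simp: null_quotient_def A_RCOSETS_def')
  \<comment> \<open>With \<open>N\<close> itself written as the coset of zero, every operation
    returns an explicit coset, and the axioms reduce to identities between representatives in
    \<open>A\<close>.\<close>
  have Q: "\<zero>\<^bsub>?Q\<^esub> = N +>\<^bsub>A\<^esub> \<zero>\<^bsub>A\<^esub>" "\<And>X Y. X \<otimes>\<^bsub>?Q\<^esub> Y = N +>\<^bsub>A\<^esub> \<zero>\<^bsub>A\<^esub>"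
    by (simp_all add: zero) (simp_all add: null_quotient_def)
  have add: "(N +>\<^bsub>A\<^esub> x) \<oplus>\<^bsub>?Q\<^esub> (N +>\<^bsub>A\<^esub> y) = N +>\<^bsub>A\<^esub> (x \<oplus>\<^bsub>A\<^esub> y)"
    if "x \<in> carrier A" "y \<in> carrier A" for x y
    using that by (simp add: null_quotient_def N.a_rcos_sum)
  note s = carr Q add null_quotient_smult[OF N]
  have grp: "abelian_group ?Q"
  proof (rule abelian_groupI)
    fix X assume "X \<in> carrier ?Q"
    then obtain x where x: "x \<in> carrier A" "X = N +>\<^bsub>A\<^esub> x" by (auto simp: carr)
    show "\<exists>Y\<in>carrier ?Q. Y \<oplus>\<^bsub>?Q\<^esub> X = \<zero>\<^bsub>?Q\<^esub>"
      using x by (intro bexI[of _ "N +>\<^bsub>A\<^esub> (\<ominus>\<^bsub>A\<^esub> x)"]) (auto simp: s M.l_neg)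
  qed (auto simp: s M.a_ac)
  have mod: "module K ?Q"
    by (rule moduleI[OF R.is_cring grp])
      (auto simp: s smult_l_distr smult_r_distr smult_assoc1)
  show ?thesis
    by (intro abelian_algebra.intro nonunital_algebra.intro mod field_axioms
        nonunital_algebra_axioms.intro abelian_algebra_axioms.intro)
      (auto simp: s)
qed

lemma null_submodule_abelian_algebra:
  assumes N: "submodule N K A"
    and null: "\<And>x y. \<lbrakk>x \<in> N; y \<in> N\<rbrakk> \<Longrightarrow> x \<otimes>\<^bsub>A\<^esub> y = \<zero>\<^bsub>A\<^esub>"
  shows "abelian_algebra K (A\<lparr>carrier := N\<rparr>)"
proof -
  interpret N: submodule N K A by fact
  interpret N: abelian_subgroup N A using N by (rule submodule_abelian_subgroup)
  have mod: "module K (A\<lparr>carrier := N\<rparr>)"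
    by (rule N.submodule_is_module) (rule module_axioms)
  show ?thesis
    by (intro abelian_algebra.intro nonunital_algebra.intro mod field_axioms
        nonunital_algebra_axioms.intro abelian_algebra_axioms.intro)
      (auto simp: null N.smult_closed)
qed

text \<open>The witness is the sequence from \<open>N\<close> through \<open>A\<close> to the cosets
  of \<open>N\<close>: \<open>null\<close> makes the kernel abelian, and \<open>prod\<close> makes
  the projection multiplicative.\<close>

lemma metabelian_if_null_submodule:
  assumes N: "submodule N K A"
    and null: "\<And>x y. \<lbrakk>x \<in> N; y \<in> N\<rbrakk> \<Longrightarrow> x \<otimes>\<^bsub>A\<^esub> y = \<zero>\<^bsub>A\<^esub>"
    and prod: "\<And>x y. \<lbrakk>x \<in> carrier A; y \<in> carrier A\<rbrakk> \<Longrightarrow> x \<otimes>\<^bsub>A\<^esub> y \<in> N"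
  shows "metabelian K A"
\<comment> \<open>The restriction of \<open>A\<close> to \<open>N\<close> keeps the record extension
  of \<open>A\<close>, whereas \<open>metabelian\<close> asks for plain \<open>module\<close>
  records; \<open>metabelianI\<close> bridges this.\<close>
proof (rule metabelianI)
  interpret N: submodule N K A by fact
  interpret N: abelian_subgroup N A using N by (rule submodule_abelian_subgroup)
  let ?Q = "null_quotient A N" and ?\<pi> = "\<lambda>x. N +>\<^bsub>A\<^esub> x"
  show "abelian_algebra K (A\<lparr>carrier := N\<rparr>)"
    using N null by (rule null_submodule_abelian_algebra)
  show "abelian_algebra K ?Q"
    using N by (rule null_quotient_abelian_algebra)
  have \<pi>: "?\<pi> \<in> nonunital_algebra_hom K A ?Q"
    \<comment> \<open>The scalar law is settled first, since unfolding
      \<open>null_quotient_def\<close> would expose the union.\<close>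
    by (auto simp: nonunital_algebra_hom_def null_quotient_smult[OF N])
      (auto simp: null_quotient_def A_RCOSETS_def' N.a_rcos_sum N.a_rcos_const prod)
  have "?\<pi> x = N \<longleftrightarrow> x \<in> N" if "x \<in> carrier A" for x
    using N.a_rcos_self[OF that] N.a_rcos_const[of x] by metis
  then have "a_kernel A ?Q ?\<pi> = {x \<in> carrier A. x \<in> N}"
    unfolding a_kernel_def' by (intro Collect_cong) (simp add: null_quotient_def cong: conj_cong)
  then have ker: "id ` carrier (A\<lparr>carrier := N\<rparr>) = a_kernel A ?Q ?\<pi>"
    using N.a_subset by auto
  have "id \<in> nonunital_algebra_hom K (A\<lparr>carrier := N\<rparr>) A"
    using N.a_subset by (auto simp: nonunital_algebra_hom_def)
  moreover have "?\<pi> ` carrier A = carrier ?Q"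
    by (auto simp: null_quotient_def A_RCOSETS_def')
  ultimately show "short_exact K (A\<lparr>carrier := N\<rparr>) id A ?\<pi> ?Q"
    using \<pi> ker unfolding short_exact_def by simp
qed

text \<open>Zero is its own multiple by the zero scalar, which bilinearity pulls out of the product.
  The negation laws below use the scalar -1 in the same way.\<close>

lemma mult_zero_l: "x \<in> carrier A \<Longrightarrow> \<zero>\<^bsub>A\<^esub> \<otimes>\<^bsub>A\<^esub> x = \<zero>\<^bsub>A\<^esub>"
  using mult_smult_l[of "\<zero>\<^bsub>K\<^esub>" "\<zero>\<^bsub>A\<^esub>" x] by (simp add: mult_closed smult_l_null)

lemma mult_zero_r: "x \<in> carrier A \<Longrightarrow> x \<otimes>\<^bsub>A\<^esub> \<zero>\<^bsub>A\<^esub> = \<zero>\<^bsub>A\<^esub>"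
  using mult_smult_r[of "\<zero>\<^bsub>K\<^esub>" x "\<zero>\<^bsub>A\<^esub>"] by (simp add: mult_closed smult_l_null)

lemma mult_minus_l:
  assumes "x \<in> carrier A" "y \<in> carrier A"
  shows "(\<ominus>\<^bsub>A\<^esub> x) \<otimes>\<^bsub>A\<^esub> y = \<ominus>\<^bsub>A\<^esub> (x \<otimes>\<^bsub>A\<^esub> y)"
  using assms mult_smult_l[of "\<ominus>\<^bsub>K\<^esub> \<one>\<^bsub>K\<^esub>" x y] by (simp add: mult_closed smult_l_minus)

lemma mult_minus_r:
  assumes "x \<in> carrier A" "y \<in> carrier A"
  shows "x \<otimes>\<^bsub>A\<^esub> (\<ominus>\<^bsub>A\<^esub> y) = \<ominus>\<^bsub>A\<^esub> (x \<otimes>\<^bsub>A\<^esub> y)"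
  using assms mult_smult_r[of "\<ominus>\<^bsub>K\<^esub> \<one>\<^bsub>K\<^esub>" x y] by (simp add: mult_closed smult_l_minus)

lemma right_annihilator_submodule:
  assumes "S \<subseteq> carrier A"
  shows "submodule {x \<in> carrier A. \<forall>s\<in>S. s \<otimes>\<^bsub>A\<^esub> x = \<zero>\<^bsub>A\<^esub>} K A"
  using assms
  by (intro submoduleI) (auto simp: mult_zero_r mult_r_distr mult_minus_r mult_smult_r subset_iff)

lemma left_annihilator_submodule:
  assumes "S \<subseteq> carrier A"
  shows "submodule {x \<in> carrier A. \<forall>s\<in>S. x \<otimes>\<^bsub>A\<^esub> s = \<zero>\<^bsub>A\<^esub>} K A"
  using assms
  by (intro submoduleI) (auto simp: mult_zero_l mult_l_distr mult_minus_l mult_smult_l subset_iff)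

lemma submodule_Int:
  assumes "submodule M K A" "submodule N K A"
  shows "submodule (M \<inter> N) K A"
  using submoduleE[OF assms(1)] submoduleE[OF assms(2)]
    submodule.axioms(1)[OF assms(1), THEN subgroup.one_closed]
    submodule.axioms(1)[OF assms(2), THEN subgroup.one_closed]
  by (intro submoduleI) auto

text \<open>A submodule is needed that contains all products and squares to zero; it is built from
  two successive annihilators.\<close>

lemma metabelian_if_mult_mult_null:
  assumes null: "\<And>x y z t. \<lbrakk>x \<in> carrier A; y \<in> carrier A; z \<in> carrier A; t \<in> carrier A\<rbrakk>
    \<Longrightarrow> (x \<otimes>\<^bsub>A\<^esub> y) \<otimes>\<^bsub>A\<^esub> (z \<otimes>\<^bsub>A\<^esub> t) = \<zero>\<^bsub>A\<^esub>"
  shows "metabelian K A"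
proof -
  define S where "S = {x \<otimes>\<^bsub>A\<^esub> y |x y. x \<in> carrier A \<and> y \<in> carrier A}"
  \<comment> \<open>Using \<open>R \<inter> L\<close> in place of the span of \<open>S\<close> avoids finite sums of products.\<close>
  define R where "R = {x \<in> carrier A. \<forall>s\<in>S. s \<otimes>\<^bsub>A\<^esub> x = \<zero>\<^bsub>A\<^esub>}"
  define L where "L = {x \<in> carrier A. \<forall>s\<in>R. x \<otimes>\<^bsub>A\<^esub> s = \<zero>\<^bsub>A\<^esub>}"
  have S: "S \<subseteq> carrier A" by (auto simp: S_def mult_closed)
  have "R \<subseteq> carrier A" by (auto simp: R_def)
  then have sub: "submodule (R \<inter> L) K A"
    unfolding L_def using S
    by (intro submodule_Int left_annihilator_submodule) (auto simp: R_def right_annihilator_submodule)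
  have "S \<subseteq> R" using S null by (auto simp: R_def S_def)
  \<comment> \<open>By its definition \<open>R\<close> is killed by \<open>S\<close> from the left,
    which is membership of \<open>S\<close> in \<open>L\<close>.\<close>
  moreover have "S \<subseteq> L" using S by (auto simp: R_def L_def)
  \<comment> \<open>For two elements of \<open>R \<inter> L\<close> the product vanishes because the
    left one lies in \<open>L\<close> and the right one in \<open>R\<close>.\<close>
  ultimately show ?thesis
    by (intro metabelian_if_null_submodule[OF sub]) (auto simp: L_def S_def)
qed

text \<open>The decomposition is an elementwise hypothesis on arbitrary \<open>P\<close> and
  \<open>V\<close>, so that the lemma also applies with their roles exchanged.\<close>

lemma mult_alternating_null:
  assumes P: "abelian_subalgebra P K A" and V: "abelian_subalgebra V K A"
    and sum: "\<And>x. x \<in> carrier A \<Longrightarrow> \<exists>p\<in>P. \<exists>v\<in>V. x = p \<oplus>\<^bsub>A\<^esub> v"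
    and el: "p \<in> P" "q \<in> P" "v \<in> V" "w \<in> V"
  shows "(p \<otimes>\<^bsub>A\<^esub> v) \<otimes>\<^bsub>A\<^esub> (q \<otimes>\<^bsub>A\<^esub> w) = \<zero>\<^bsub>A\<^esub>"
proof -
  have PA: "P \<subseteq> carrier A" and VA: "V \<subseteq> carrier A"
    using P V submoduleE(1) by (auto simp: abelian_subalgebra_def nonunital_subalgebra_def)
  have PP: "x \<otimes>\<^bsub>A\<^esub> y = \<zero>\<^bsub>A\<^esub>" if "x \<in> P" "y \<in> P" for x y
    using P that by (simp add: abelian_subalgebra_def)
  have VV: "x \<otimes>\<^bsub>A\<^esub> y = \<zero>\<^bsub>A\<^esub>" if "x \<in> V" "y \<in> V" for x y
    using V that by (simp add: abelian_subalgebra_def)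
  have c: "p \<in> carrier A" "q \<in> carrier A" "v \<in> carrier A" "w \<in> carrier A"
    using el PA VA by auto
  obtain p' v' where d: "p' \<in> P" "v' \<in> V" "v \<otimes>\<^bsub>A\<^esub> q = p' \<oplus>\<^bsub>A\<^esub> v'"
    using sum[OF mult_closed[OF c(3,2)]] by blast
  then have c': "p' \<in> carrier A" "v' \<in> carrier A" using PA VA by auto
  have "(p \<otimes>\<^bsub>A\<^esub> v) \<otimes>\<^bsub>A\<^esub> (q \<otimes>\<^bsub>A\<^esub> w) = (p \<otimes>\<^bsub>A\<^esub> (v \<otimes>\<^bsub>A\<^esub> q)) \<otimes>\<^bsub>A\<^esub> w"
    using c by (simp add: mult_assoc mult_closed)
  \<comment> \<open>The left factor \<open>p\<close> kills \<open>p'\<close>; in the next step the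
    right factor \<open>w\<close> kills \<open>v'\<close>.\<close>
  also have "\<dots> = (p \<otimes>\<^bsub>A\<^esub> v') \<otimes>\<^bsub>A\<^esub> w"
    using c c' d el by (simp add: mult_r_distr PP mult_closed)
  also have "\<dots> = \<zero>\<^bsub>A\<^esub>"
    using c c' d el by (simp add: mult_assoc VV mult_zero_r)
  finally show ?thesis .
qed

end

theorem corollary2p4:
  fixes K :: "('k, 'm) ring_scheme"
    and A :: "('k, 'a, 'n) module_scheme"
    and P\<^sub>0 V\<^sub>0 :: "'a set"
  assumes "nonunital_algebra K A"
    and "abelian_subalgebra P\<^sub>0 K A"
    and "abelian_subalgebra V\<^sub>0 K A"
    and "carrier A = P\<^sub>0 <+>\<^bsub>A\<^esub> V\<^sub>0"
  shows "metabelian K A"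
proof -
  interpret nonunital_algebra K A by fact
  have PA: "P\<^sub>0 \<subseteq> carrier A" and VA: "V\<^sub>0 \<subseteq> carrier A"
    using assms(2,3) submoduleE(1) by (auto simp: abelian_subalgebra_def nonunital_subalgebra_def)
  have PP: "x \<otimes>\<^bsub>A\<^esub> y = \<zero>\<^bsub>A\<^esub>" if "x \<in> P\<^sub>0" "y \<in> P\<^sub>0" for x y
    using assms(2) that by (simp add: abelian_subalgebra_def)
  have VV: "x \<otimes>\<^bsub>A\<^esub> y = \<zero>\<^bsub>A\<^esub>" if "x \<in> V\<^sub>0" "y \<in> V\<^sub>0" for x y
    using assms(3) that by (simp add: abelian_subalgebra_def)
  have sum: "\<exists>p\<in>P\<^sub>0. \<exists>v\<in>V\<^sub>0. x = p \<oplus>\<^bsub>A\<^esub> v" if "x \<in> carrier A" for x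
    using that unfolding assms(4) set_add_def' by blast
  have sum': "\<exists>v\<in>V\<^sub>0. \<exists>p\<in>P\<^sub>0. x = v \<oplus>\<^bsub>A\<^esub> p" if x: "x \<in> carrier A" for x
    using sum[OF x] PA VA M.a_comm by blast
  \<comment> \<open>Of the four terms of an expanded product, only the two mixed ones
    survive.\<close>
  have prod: "\<exists>p\<in>P\<^sub>0. \<exists>v\<in>V\<^sub>0. \<exists>q\<in>P\<^sub>0. \<exists>w\<in>V\<^sub>0. x \<otimes>\<^bsub>A\<^esub> y = p \<otimes>\<^bsub>A\<^esub> v \<oplus>\<^bsub>A\<^esub> w \<otimes>\<^bsub>A\<^esub> q"
    if x: "x \<in> carrier A" and y: "y \<in> carrier A" for x y
  proof -
    obtain p w where pw: "p \<in> P\<^sub>0" "w \<in> V\<^sub>0" "x = p \<oplus>\<^bsub>A\<^esub> w" using sum[OF x] by blast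
    obtain q v where qv: "q \<in> P\<^sub>0" "v \<in> V\<^sub>0" "y = q \<oplus>\<^bsub>A\<^esub> v" using sum[OF y] by blast
    have c: "p \<in> carrier A" "q \<in> carrier A" "v \<in> carrier A" "w \<in> carrier A"
      using pw qv PA VA by auto
    have "x \<otimes>\<^bsub>A\<^esub> y = p \<otimes>\<^bsub>A\<^esub> v \<oplus>\<^bsub>A\<^esub> w \<otimes>\<^bsub>A\<^esub> q"
      using pw qv c by (simp add: mult_l_distr mult_r_distr mult_closed PP VV M.a_comm)
    then show ?thesis using pw qv by blast
  qed
  \<comment> \<open>This disposes of the fourfold products that do not alternate: their two middle
    factors lie in the same subalgebra.\<close>
  have inner: "(x \<otimes>\<^bsub>A\<^esub> a) \<otimes>\<^bsub>A\<^esub> (b \<otimes>\<^bsub>A\<^esub> y) = \<zero>\<^bsub>A\<^esub>"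
    if "x \<in> carrier A" "a \<in> carrier A" "b \<in> carrier A" "y \<in> carrier A" "a \<otimes>\<^bsub>A\<^esub> b = \<zero>\<^bsub>A\<^esub>" for x a b y
  proof -
    have "(x \<otimes>\<^bsub>A\<^esub> a) \<otimes>\<^bsub>A\<^esub> (b \<otimes>\<^bsub>A\<^esub> y) = x \<otimes>\<^bsub>A\<^esub> ((a \<otimes>\<^bsub>A\<^esub> b) \<otimes>\<^bsub>A\<^esub> y)"
      using that(1-4) by (simp add: mult_assoc mult_closed)
    then show ?thesis using that by (simp add: mult_zero_l mult_zero_r)
  qed
  show ?thesis
  proof (rule metabelian_if_mult_mult_null)
    fix x y z t
    assume "x \<in> carrier A" "y \<in> carrier A" "z \<in> carrier A" "t \<in> carrier A"
    then obtain p v q w p' v' q' w'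
      where el: "p \<in> P\<^sub>0" "q \<in> P\<^sub>0" "p' \<in> P\<^sub>0" "q' \<in> P\<^sub>0"
          "v \<in> V\<^sub>0" "w \<in> V\<^sub>0" "v' \<in> V\<^sub>0" "w' \<in> V\<^sub>0"
        and xy: "x \<otimes>\<^bsub>A\<^esub> y = p \<otimes>\<^bsub>A\<^esub> v \<oplus>\<^bsub>A\<^esub> w \<otimes>\<^bsub>A\<^esub> q"
        and zt: "z \<otimes>\<^bsub>A\<^esub> t = p' \<otimes>\<^bsub>A\<^esub> v' \<oplus>\<^bsub>A\<^esub> w' \<otimes>\<^bsub>A\<^esub> q'"
      using prod[of x y] prod[of z t] by blast
    have c: "p \<in> carrier A" "q \<in> carrier A" "p' \<in> carrier A" "q' \<in> carrier A"
        "v \<in> carrier A" "w \<in> carrier A" "v' \<in> carrier A" "w' \<in> carrier A"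
      using el PA VA by auto
    \<comment> \<open>Expansion leaves four terms: \<open>inner\<close> removes the two whose middle
      factors are \<open>v\<close>, \<open>w'\<close> or \<open>q\<close>, \<open>p'\<close>, and
      the alternating lemma, in both orders, removes the other two.\<close>
    show "(x \<otimes>\<^bsub>A\<^esub> y) \<otimes>\<^bsub>A\<^esub> (z \<otimes>\<^bsub>A\<^esub> t) = \<zero>\<^bsub>A\<^esub>"
      unfolding xy zt using el c
      by (simp add: mult_l_distr mult_r_distr mult_closed inner PP VV
          mult_alternating_null[OF assms(2,3) sum] mult_alternating_null[OF assms(3,2) sum'])
  qed
qed

end
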